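(* For a binary matrix $\mathbf{X}$, the rectangle cover graph $\mathcal{G}(\mathbf{X})$ contains a $5$-hole (an induced chordless cycle on $5$ vertices) if and only if $\mathbf{X}$ has a submatrix which, after permuting its rows and columns, equals one of $\mathbf{D}_4$, $\mathbf{H}_3$, $\mathbf{H}_3^\top$ or $\mathbf{K}_5$.
   Context: For a binary matrix $\mathbf{X}$, $\mathrm{supp}(\mathbf{X})=\{(i,j):x_{i,j}=1\}$; a submatrix is obtained by deleting rows and columns; a rectangle is a set $I\times J\subseteq\mathrm{supp}(\mathbf{X})$. The rectangle cover graph $\mathcal{G}(\mathbf{X})$ has vertex set $\mathrm{supp}(\mathbf{X})$, two vertices being adjacent iff some rectangle of $\mathbf{X}$ contains both. The matrices: $\mathbf{D}_4=\begin{bmatrix}0&1&1&0\\1&1&1&0\\1&1&1&1\\0&0&1&1\end{bmatrix}$; $\mathbf{H}_3=[\mathbf{1},\mathbf{C}_3]=\begin{bmatrix}1&1&1&0\\1&0&1&1\\1&1&0&1\end{bmatrix}$, where $\mathbf{C}_3$ has $1$s exactly at $(1,1),(1,2),(2,2),(2,3),(3,1),(3,3)$ and $\mathbf{1}$ is the all-ones column; $\mathbf{K}_5\in\{0,1\}^{5\times5}$ is the circulant matrix with $(i,j)$-entry $1$ iff $j-i\equiv 0,1,2 \pmod 5$ (exactly three $1$s in each row and column). *)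

theory Defs
  imports Main
begin

text \<open>A binary m x n matrix is represented by a Boolean function on indices
  (0-based); only entries with i < m and j < n are relevant. True means entry 1.\<close>

definition supp :: "nat \<Rightarrow> nat \<Rightarrow> (nat \<Rightarrow> nat \<Rightarrow> bool) \<Rightarrow> (nat \<times> nat) set" where
  "supp m n X = {(i, j). i < m \<and> j < n \<and> X i j}"

definition is_rectangle :: "nat \<Rightarrow> nat \<Rightarrow> (nat \<Rightarrow> nat \<Rightarrow> bool) \<Rightarrow> (nat \<times> nat) set \<Rightarrow> bool" where
  "is_rectangle m n X R = (\<exists>I J. R = I \<times> J \<and> I \<times> J \<subseteq> supp m n X)"

definition rc_adj :: "nat \<Rightarrow> nat \<Rightarrow> (nat \<Rightarrow> nat \<Rightarrow> bool) \<Rightarrow> nat \<times> nat \<Rightarrow> nat \<times> nat \<Rightarrow> bool" where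
  "rc_adj m n X u v =
     (u \<in> supp m n X \<and> v \<in> supp m n X \<and> u \<noteq> v \<and>
      (\<exists>R. is_rectangle m n X R \<and> u \<in> R \<and> v \<in> R))"

definition has_5hole :: "nat \<Rightarrow> nat \<Rightarrow> (nat \<Rightarrow> nat \<Rightarrow> bool) \<Rightarrow> bool" where
  "has_5hole m n X =
     (\<exists>v :: nat \<Rightarrow> nat \<times> nat.
        (\<forall>k<5. v k \<in> supp m n X) \<and> inj_on v {..<5} \<and>
        (\<forall>a<5. \<forall>b<5. rc_adj m n X (v a) (v b) \<longleftrightarrow>
                       ((a + 1) mod 5 = b \<or> (b + 1) mod 5 = a)))"

text \<open>X (m x n) has a submatrix which, after permuting rows and columns, equals P (p x q):
  choose distinct rows r 0..r (p-1) and distinct columns c 0..c (q-1) in arbitrary order.\<close>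
definition has_perm_submatrix ::
  "nat \<Rightarrow> nat \<Rightarrow> (nat \<Rightarrow> nat \<Rightarrow> bool) \<Rightarrow> nat \<Rightarrow> nat \<Rightarrow> (nat \<Rightarrow> nat \<Rightarrow> bool) \<Rightarrow> bool" where
  "has_perm_submatrix m n X p q P =
     (\<exists>r c. inj_on r {..<p} \<and> r ` {..<p} \<subseteq> {..<m} \<and>
            inj_on c {..<q} \<and> c ` {..<q} \<subseteq> {..<n} \<and>
            (\<forall>i<p. \<forall>j<q. X (r i) (c j) = P i j))"

definition mat_of_rows :: "nat list list \<Rightarrow> nat \<Rightarrow> nat \<Rightarrow> bool" where
  "mat_of_rows xss i j = (xss ! i ! j = 1)"

definition D4 :: "nat \<Rightarrow> nat \<Rightarrow> bool" where
  "D4 = mat_of_rows [[0,1,1,0],[1,1,1,0],[1,1,1,1],[0,0,1,1]]"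

definition H3 :: "nat \<Rightarrow> nat \<Rightarrow> bool" where
  "H3 = mat_of_rows [[1,1,1,0],[1,0,1,1],[1,1,0,1]]"

definition H3T :: "nat \<Rightarrow> nat \<Rightarrow> bool" where
  "H3T i j = H3 j i"

definition K5 :: "nat \<Rightarrow> nat \<Rightarrow> bool" where
  "K5 i j = ((int j - int i) mod 5 \<in> {0, 1, 2})"

end

theory Submission
  imports Defs
begin

text \<open>
  Two support entries \<open>u\<close>, \<open>v\<close> are adjacent iff the two other corners of the rectangle they span
  are 1. Hence the 5-hole \<open>p0, \<dots>, p4\<close> is determined by the 5x5 matrix of the entries
  \<open>M a b = X (fst (p a)) (snd (p b))\<close>: it is 1 on the diagonal and at cyclically neighbouring
  indices, and among \<open>M a (a+2)\<close>, \<open>M (a+2) a\<close> at least one is 0. Rows or columns of \<open>M\<close> may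
  repeat, which is harmless because each of the four forbidden matrices has distinct rows and
  distinct columns. If all ten free entries are 0, then \<open>M\<close> is \<open>K5\<close> up to a cyclic shift.
  Otherwise, up to rotation, reflection and transposition, a 3x4 submatrix equal to \<open>H3\<close> or
  a 4x4 submatrix equal to \<open>D4\<close> is found from at most five of the free entries.
\<close>

section \<open>Adjacency and 5-holes in terms of matrix entries\<close>

definition rc_edge :: "(nat \<Rightarrow> nat \<Rightarrow> bool) \<Rightarrow> nat \<times> nat \<Rightarrow> nat \<times> nat \<Rightarrow> bool" where
  "rc_edge X u v \<longleftrightarrow> X (fst u) (snd v) \<and> X (fst v) (snd u)"

lemma rc_adj_iff:
  "rc_adj m n X u v \<longleftrightarrow> u \<in> supp m n X \<and> v \<in> supp m n X \<and> u \<noteq> v \<and> rc_edge X u v"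
proof
  assume "rc_adj m n X u v"
  then show "u \<in> supp m n X \<and> v \<in> supp m n X \<and> u \<noteq> v \<and> rc_edge X u v"
    by (auto simp: rc_adj_def is_rectangle_def supp_def rc_edge_def)
next
  assume *: "u \<in> supp m n X \<and> v \<in> supp m n X \<and> u \<noteq> v \<and> rc_edge X u v"
  \<comment> \<open>This is the smallest rectangle containing both \<open>u\<close> and
    \<open>v\<close>.\<close>
  then have "{fst u, fst v} \<times> {snd u, snd v} \<subseteq> supp m n X"
    by (auto simp: supp_def rc_edge_def)
  then have "is_rectangle m n X ({fst u, fst v} \<times> {snd u, snd v})"
    unfolding is_rectangle_def by blast
  moreover have "u \<in> {fst u, fst v} \<times> {snd u, snd v}" "v \<in> {fst u, fst v} \<times> {snd u, snd v}"
    by (auto simp: mem_Times_iff)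
  ultimately show "rc_adj m n X u v"
    using * unfolding rc_adj_def by metis
qed

text \<open>Distinctness of the five entries is implied: \<open>rc_edge\<close> is reflexive on the
  support, so the non-edges separate them.\<close>

definition hole5 where
  "hole5 m n X p0 p1 p2 p3 p4 \<longleftrightarrow>
     {p0, p1, p2, p3, p4} \<subseteq> supp m n X \<and>
     rc_edge X p0 p1 \<and> rc_edge X p1 p2 \<and> rc_edge X p2 p3 \<and> rc_edge X p3 p4 \<and> rc_edge X p4 p0 \<and>
     \<not> rc_edge X p0 p2 \<and> \<not> rc_edge X p1 p3 \<and> \<not> rc_edge X p2 p4 \<and> \<not> rc_edge X p3 p0 \<and>
     \<not> rc_edge X p4 p1"

lemma rc_edge_commute: "rc_edge X u v \<longleftrightarrow> rc_edge X v u"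
  by (auto simp: rc_edge_def)

lemma hole5_rotate: "hole5 m n X p0 p1 p2 p3 p4 \<Longrightarrow> hole5 m n X p1 p2 p3 p4 p0"
  by (auto simp: hole5_def rc_edge_commute)

lemma hole5_reflect: "hole5 m n X p0 p1 p2 p3 p4 \<Longrightarrow> hole5 m n X p0 p4 p3 p2 p1"
  by (auto simp: hole5_def rc_edge_def)

lemma hole5_transpose:
  "hole5 m n X p0 p1 p2 p3 p4 \<Longrightarrow>
   hole5 n m (\<lambda>i j. X j i) (prod.swap p0) (prod.swap p1) (prod.swap p2) (prod.swap p3) (prod.swap p4)"
  by (auto simp: hole5_def rc_edge_def supp_def)

text \<open>If \<open>p0 = p1\<close>, the edge from \<open>p1\<close> to \<open>p2\<close> would be
  the excluded edge from \<open>p0\<close> to \<open>p2\<close>. The five rotations of these two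
  inequalities cover all ten pairs.\<close>

lemma hole5_neq:
  assumes "hole5 m n X p0 p1 p2 p3 p4"
  shows "p0 \<noteq> p1" "p0 \<noteq> p2"
  using assms by (auto simp: hole5_def rc_edge_def supp_def)

lemma all_less_numeral:
  "(\<forall>k<3. P k) \<longleftrightarrow> P 0 \<and> P 1 \<and> P (2::nat)"
  "(\<forall>k<4. P k) \<longleftrightarrow> P 0 \<and> P 1 \<and> P 2 \<and> P (3::nat)"
  "(\<forall>k<5. P k) \<longleftrightarrow> P 0 \<and> P 1 \<and> P 2 \<and> P 3 \<and> P (4::nat)"
  by (auto simp: numeral_eq_Suc less_Suc_eq)

lemma has_5hole_iff: "has_5hole m n X \<longleftrightarrow> (\<exists>p0 p1 p2 p3 p4. hole5 m n X p0 p1 p2 p3 p4)"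
proof
  assume "has_5hole m n X"
  then obtain v :: "nat \<Rightarrow> nat \<times> nat" where v: "\<And>k. k < 5 \<Longrightarrow> v k \<in> supp m n X" "inj_on v {..<5}"
    "\<And>a b. a < 5 \<Longrightarrow> b < 5 \<Longrightarrow>
       rc_adj m n X (v a) (v b) \<longleftrightarrow> (a + 1) mod 5 = b \<or> (b + 1) mod 5 = a"
    unfolding has_5hole_def by blast
  have "rc_edge X (v a) (v b) \<longleftrightarrow> (a + 1) mod 5 = b \<or> (b + 1) mod 5 = a"
    if "a < 5" "b < 5" "a \<noteq> b" for a b
    using v(3)[OF that(1,2)] v(1) inj_onD[OF v(2)] that unfolding rc_adj_iff by auto
  then have "hole5 m n X (v 0) (v 1) (v 2) (v 3) (v 4)"
    using v(1) by (simp add: hole5_def)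
  then show "\<exists>p0 p1 p2 p3 p4. hole5 m n X p0 p1 p2 p3 p4" by blast
next
  assume "\<exists>p0 p1 p2 p3 p4. hole5 m n X p0 p1 p2 p3 p4"
  then obtain p0 p1 p2 p3 p4 where h0: "hole5 m n X p0 p1 p2 p3 p4" by blast
  note h1 = hole5_rotate[OF h0]
  note h2 = hole5_rotate[OF h1]
  note h3 = hole5_rotate[OF h2]
  note h4 = hole5_rotate[OF h3]
  note neq = hole5_neq[OF h0] hole5_neq[OF h1] hole5_neq[OF h2] hole5_neq[OF h3] hole5_neq[OF h4]
  let ?v = "(!) [p0, p1, p2, p3, p4]"
  have "\<forall>k<5. ?v k \<in> supp m n X"
    using h0 unfolding all_less_numeral by (simp add: hole5_def)
  moreover have "inj_on ?v {..<5}"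
    using neq by (intro inj_on_nth) auto
  moreover have "\<forall>a<5. \<forall>b<5. rc_adj m n X (?v a) (?v b) \<longleftrightarrow> (a + 1) mod 5 = b \<or> (b + 1) mod 5 = a"
    using h0 neq unfolding all_less_numeral rc_adj_iff
    by (simp add: hole5_def rc_edge_commute)
  ultimately show "has_5hole m n X" unfolding has_5hole_def by blast
qed

section \<open>Forbidden submatrices and transposition\<close>

definition has_forbidden where
  "has_forbidden m n X \<longleftrightarrow>
     has_perm_submatrix m n X 4 4 D4 \<or> has_perm_submatrix m n X 3 4 H3 \<or>
     has_perm_submatrix m n X 4 3 H3T \<or> has_perm_submatrix m n X 5 5 K5"

text \<open>Two indices selecting the same row of \<open>X\<close> would give equal rows of
  \<open>P\<close>, and likewise for columns. So injectivity of \<open>r\<close> and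
  \<open>c\<close> is inherited from \<open>P\<close>, and rows or columns shared by hole vertices
  need no case distinction.\<close>

lemma has_perm_submatrixI:
  assumes "\<And>i i'. i < p \<Longrightarrow> i' < p \<Longrightarrow> (\<forall>j<q. P i j = P i' j) \<Longrightarrow> i = i'"
    and "\<And>j j'. j < q \<Longrightarrow> j' < q \<Longrightarrow> (\<forall>i<p. P i j = P i j') \<Longrightarrow> j = j'"
    and "\<forall>i<p. r i < m" and "\<forall>j<q. c j < n"
    and "\<forall>i<p. \<forall>j<q. X (r i) (c j) = P i j"
  shows "has_perm_submatrix m n X p q P"
proof -
  have "inj_on r {..<p}" "inj_on c {..<q}"
    using assms(1,2,5) by (auto intro!: inj_onI) metis+
  with assms(3-5) show ?thesis
    unfolding has_perm_submatrix_def by blast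
qed

lemma has_perm_submatrixE:
  assumes "has_perm_submatrix m n X p q P"
  obtains r c where "\<forall>i<p. r i < m" "\<forall>j<q. c j < n" "\<forall>i<p. \<forall>j<q. X (r i) (c j) = P i j"
  using assms unfolding has_perm_submatrix_def by (auto simp: image_subset_iff)

lemma D4_I:
  assumes "\<forall>i<4. r i < m" "\<forall>j<4. c j < n" "\<forall>i<4. \<forall>j<4. X (r i) (c j) = D4 i j"
  shows "has_perm_submatrix m n X 4 4 D4"
proof (rule has_perm_submatrixI[OF _ _ assms])
  have "\<forall>i<4. \<forall>i'<4. (\<forall>j<4. D4 i j = D4 i' j) \<longrightarrow> i = i'"
    "\<forall>j<4. \<forall>j'<4. (\<forall>i<4. D4 i j = D4 i j') \<longrightarrow> j = j'"
    unfolding all_less_numeral by (simp_all add: D4_def mat_of_rows_def)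
  then show "\<And>i i'. i < 4 \<Longrightarrow> i' < 4 \<Longrightarrow> \<forall>j<4. D4 i j = D4 i' j \<Longrightarrow> i = i'"
    "\<And>j j'. j < 4 \<Longrightarrow> j' < 4 \<Longrightarrow> \<forall>i<4. D4 i j = D4 i j' \<Longrightarrow> j = j'" by blast+
qed

lemma H3_I:
  assumes "\<forall>i<3. r i < m" "\<forall>j<4. c j < n" "\<forall>i<3. \<forall>j<4. X (r i) (c j) = H3 i j"
  shows "has_perm_submatrix m n X 3 4 H3"
proof (rule has_perm_submatrixI[OF _ _ assms])
  have "\<forall>i<3. \<forall>i'<3. (\<forall>j<4. H3 i j = H3 i' j) \<longrightarrow> i = i'"
    "\<forall>j<4. \<forall>j'<4. (\<forall>i<3. H3 i j = H3 i j') \<longrightarrow> j = j'"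
    unfolding all_less_numeral by (simp_all add: H3_def mat_of_rows_def)
  then show "\<And>i i'. i < 3 \<Longrightarrow> i' < 3 \<Longrightarrow> \<forall>j<4. H3 i j = H3 i' j \<Longrightarrow> i = i'"
    "\<And>j j'. j < 4 \<Longrightarrow> j' < 4 \<Longrightarrow> \<forall>i<3. H3 i j = H3 i j' \<Longrightarrow> j = j'" by blast+
qed

lemma K5_I:
  assumes "\<forall>i<5. r i < m" "\<forall>j<5. c j < n" "\<forall>i<5. \<forall>j<5. X (r i) (c j) = K5 i j"
  shows "has_perm_submatrix m n X 5 5 K5"
proof (rule has_perm_submatrixI[OF _ _ assms])
  have "\<forall>i<5. \<forall>i'<5. (\<forall>j<5. K5 i j = K5 i' j) \<longrightarrow> i = i'"
    "\<forall>j<5. \<forall>j'<5. (\<forall>i<5. K5 i j = K5 i j') \<longrightarrow> j = j'"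
    unfolding all_less_numeral by (simp_all add: K5_def)
  then show "\<And>i i'. i < 5 \<Longrightarrow> i' < 5 \<Longrightarrow> \<forall>j<5. K5 i j = K5 i' j \<Longrightarrow> i = i'"
    "\<And>j j'. j < 5 \<Longrightarrow> j' < 5 \<Longrightarrow> \<forall>i<5. K5 i j = K5 i j' \<Longrightarrow> j = j'" by blast+
qed

lemma has_perm_submatrix_transpose:
  "has_perm_submatrix n m (\<lambda>i j. X j i) q p (\<lambda>i j. P j i) \<longleftrightarrow> has_perm_submatrix m n X p q P"
  unfolding has_perm_submatrix_def by (subst ex_comm) (intro ex_cong1; blast)

text \<open>The list of forbidden matrices is closed under transposition: \<open>D4\<close> is
  symmetric, \<open>H3\<close> and \<open>H3T\<close> are exchanged, and the transpose of
  \<open>K5\<close> is a permutation of \<open>K5\<close>.\<close>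

lemma has_forbidden_transposeD:
  assumes "has_forbidden n m (\<lambda>i j. X j i)"
  shows "has_forbidden m n X"
proof -
  have D4: "D4 j i = D4 i j" if "i < 4" "j < 4" for i j
  proof -
    have "\<forall>i<4. \<forall>j<4. D4 j i = D4 i j"
      unfolding all_less_numeral by (simp add: D4_def mat_of_rows_def)
    with that show ?thesis by blast
  qed
  from assms consider "has_perm_submatrix n m (\<lambda>i j. X j i) 4 4 D4"
    | "has_perm_submatrix n m (\<lambda>i j. X j i) 3 4 H3"
    | "has_perm_submatrix n m (\<lambda>i j. X j i) 4 3 H3T"
    | "has_perm_submatrix n m (\<lambda>i j. X j i) 5 5 K5"
    unfolding has_forbidden_def by blast
  then show ?thesis
  proof cases
    case 1
    then have "has_perm_submatrix m n X 4 4 (\<lambda>i j. D4 j i)"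
      using has_perm_submatrix_transpose[of n m X 4 4 "\<lambda>i j. D4 j i"] by simp
    then have "has_perm_submatrix m n X 4 4 D4"
      by (simp add: has_perm_submatrix_def D4 cong: conj_cong)
    then show ?thesis by (simp add: has_forbidden_def)
  next
    case 2
    then have "has_perm_submatrix m n X 4 3 H3T"
      using has_perm_submatrix_transpose[of n m X 3 4 H3T] by (simp add: H3T_def)
    then show ?thesis by (simp add: has_forbidden_def)
  next
    case 3
    then have "has_perm_submatrix m n X 3 4 H3"
      using has_perm_submatrix_transpose[of n m X 4 3 H3] by (simp add: H3T_def[abs_def])
    then show ?thesis by (simp add: has_forbidden_def)
  next
    case 4
    then obtain r c where rc: "\<forall>i<5. r i < n" "\<forall>j<5. c j < m" "\<forall>i<5. \<forall>j<5. X (c j) (r i) = K5 i j"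
      by (rule has_perm_submatrixE)
    \<comment> \<open>Reversing both index orders undoes the transposition of the circulant, since
      (4 - i) - (4 - j) = j - i.\<close>
    have "has_perm_submatrix m n X 5 5 K5"
      by (rule K5_I[where r = "\<lambda>i. c (4 - i)" and c = "\<lambda>j. r (4 - j)"];
          use rc in \<open>unfold all_less_numeral\<close>; simp add: K5_def)
    then show ?thesis by (simp add: has_forbidden_def)
  qed
qed

section \<open>From a 5-hole to a forbidden submatrix\<close>

lemma hole5_step:
  assumes h: "hole5 m n X p0 p1 p2 p3 p4" and nf: "\<not> has_forbidden m n X"
    and "X (fst p0) (snd p3)" "\<not> X (fst p0) (snd p2)"
  shows "X (fst p2) (snd p4)"
proof (rule ccontr)
  assume "\<not> X (fst p2) (snd p4)"
  note * = this assms(3,4) h[unfolded hole5_def rc_edge_def supp_def]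
  have "has_perm_submatrix m n X 3 4 H3"
  \<comment> \<open>\<open>M 3 0\<close> is 0 because \<open>M 0 3\<close> is 1. If
    \<open>M 3 1\<close> is 1, then \<open>M 1 3\<close> is 0 and column \<open>snd p1\<close>
    becomes the all-ones column of \<open>H3\<close>; otherwise column \<open>snd p3\<close>
    does.\<close>
  proof (cases "X (fst p3) (snd p1)")
    case True
    show ?thesis
      by (rule H3_I[where r = "(!) [fst p0, fst p1, fst p3]"
            and c = "(!) [snd p1, snd p3, snd p0, snd p2]"];
          use * True in \<open>unfold all_less_numeral\<close>; auto simp: H3_def mat_of_rows_def)
  next
    case False
    show ?thesis
      by (rule H3_I[where r = "(!) [fst p0, fst p2, fst p3]"
            and c = "(!) [snd p3, snd p4, snd p1, snd p2]"];
          use * False in \<open>unfold all_less_numeral\<close>; auto simp: H3_def mat_of_rows_def)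
  qed
  with nf show False by (simp add: has_forbidden_def)
qed

text \<open>As \<open>M 3 1\<close> is 1, non-adjacency of \<open>p1\<close> and \<open>p3\<close>
  makes \<open>M 1 3\<close> 0. If \<open>M 2 4\<close> were 0 too, every entry of a copy of
  \<open>D4\<close> would be determined.\<close>

lemma hole5_D4:
  assumes h: "hole5 m n X p0 p1 p2 p3 p4" and nf: "\<not> has_forbidden m n X"
    and "X (fst p3) (snd p1)" "\<not> X (fst p0) (snd p2)" "\<not> X (fst p0) (snd p3)" "\<not> X (fst p1) (snd p4)"
  shows "X (fst p2) (snd p4)"
proof (rule ccontr)
  assume "\<not> X (fst p2) (snd p4)"
  note * = this assms(3-6) h[unfolded hole5_def rc_edge_def supp_def]
  have "has_perm_submatrix m n X 4 4 D4"
    by (rule D4_I[where r = "(!) [fst p1, fst p2, fst p3, fst p0]"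
          and c = "(!) [snd p3, snd p2, snd p1, snd p4]"];
        use * in \<open>unfold all_less_numeral\<close>; auto simp: D4_def mat_of_rows_def)
  with nf show False by (simp add: has_forbidden_def)
qed

lemma hole5_K5:
  assumes h: "hole5 m n X p0 p1 p2 p3 p4"
    and "\<not> X (fst p0) (snd p2)" "\<not> X (fst p2) (snd p0)" "\<not> X (fst p1) (snd p3)" "\<not> X (fst p3) (snd p1)"
      "\<not> X (fst p2) (snd p4)" "\<not> X (fst p4) (snd p2)" "\<not> X (fst p3) (snd p0)" "\<not> X (fst p0) (snd p3)"
      "\<not> X (fst p4) (snd p1)" "\<not> X (fst p1) (snd p4)"
  shows "has_forbidden m n X"
proof -
  note * = assms(2-) h[unfolded hole5_def rc_edge_def supp_def]
  have "has_perm_submatrix m n X 5 5 K5"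
    \<comment> \<open>Here \<open>M a b\<close> is 1 iff b - a is -1, 0 or 1 modulo 5; starting the
      columns at \<open>snd p4\<close> shifts these differences to 0, 1, 2.\<close>
    by (rule K5_I[where r = "(!) [fst p0, fst p1, fst p2, fst p3, fst p4]"
          and c = "(!) [snd p4, snd p0, snd p1, snd p2, snd p3]"];
        use * in \<open>unfold all_less_numeral\<close>; auto simp: K5_def)
  then show ?thesis by (simp add: has_forbidden_def)
qed

lemma hole5_step_transpose:
  assumes "hole5 m n X p0 p1 p2 p3 p4" "\<not> has_forbidden m n X"
    and "X (fst p3) (snd p0)" "\<not> X (fst p2) (snd p0)"
  shows "X (fst p4) (snd p2)"
  using hole5_step[OF hole5_transpose[OF assms(1)]] assms(2-) has_forbidden_transposeD[of n m X]
  by auto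

lemma hole5_D4_transpose:
  assumes "hole5 m n X p0 p1 p2 p3 p4" "\<not> has_forbidden m n X"
    and "X (fst p1) (snd p3)" "\<not> X (fst p2) (snd p0)" "\<not> X (fst p3) (snd p0)" "\<not> X (fst p4) (snd p1)"
  shows "X (fst p4) (snd p2)"
  using hole5_D4[OF hole5_transpose[OF assms(1)]] assms(2-) has_forbidden_transposeD[of n m X]
  by auto

lemma hole5_has_forbidden:
  assumes h0: "hole5 m n X p0 p1 p2 p3 p4"
  shows "has_forbidden m n X"
proof (rule ccontr)
  assume nf: "\<not> has_forbidden m n X"
  note h1 = hole5_rotate[OF h0]
  note h2 = hole5_rotate[OF h1]
  note h3 = hole5_rotate[OF h2]
  note h4 = hole5_rotate[OF h3]
  note h = h0 h1 h2 h3 h4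
  note g = h[THEN hole5_reflect]
  note step = h[THEN hole5_step, OF nf] g[THEN hole5_step, OF nf]
    h[THEN hole5_step_transpose, OF nf] g[THEN hole5_step_transpose, OF nf]
  \<comment> \<open>As clauses, the reflected instances of \<open>hole5_D4\<close> are the
    transposed ones, so rotations and transposition give all of them.\<close>
  note d4 = h[THEN hole5_D4, OF nf] h[THEN hole5_D4_transpose, OF nf]
  have nonadj: "\<not> (X (fst p0) (snd p2) \<and> X (fst p2) (snd p0))"
    "\<not> (X (fst p1) (snd p3) \<and> X (fst p3) (snd p1))"
    "\<not> (X (fst p2) (snd p4) \<and> X (fst p4) (snd p2))"
    "\<not> (X (fst p3) (snd p0) \<and> X (fst p0) (snd p3))"
    "\<not> (X (fst p4) (snd p1) \<and> X (fst p1) (snd p4))"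
    using h0 by (simp_all add: hole5_def rc_edge_def)
  show False
    \<comment> \<open>A propositional problem in the ten free entries. By \<open>step\<close>, each
      1 of the form \<open>M a (a+2)\<close> forces two of the form \<open>M (b+2) b\<close>, and
      conversely; \<open>nonadj\<close> allows at most five 1s. The nonzero patterns that remain
      violate \<open>d4\<close>, and the zero pattern gives \<open>K5\<close>.\<close>
    using step d4 nonadj hole5_K5[OF h0] nf by sat
qed

section \<open>A 5-hole inside each forbidden matrix\<close>

lemma has_forbidden_has_5hole:
  assumes "has_forbidden m n X"
  shows "has_5hole m n X"
proof -
  from assms consider "has_perm_submatrix m n X 4 4 D4" | "has_perm_submatrix m n X 3 4 H3"
    | "has_perm_submatrix m n X 4 3 H3T" | "has_perm_submatrix m n X 5 5 K5"
    unfolding has_forbidden_def by blast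
  then have "\<exists>p0 p1 p2 p3 p4. hole5 m n X p0 p1 p2 p3 p4"
  proof cases
    case 1
    then obtain r c where "\<forall>i<4. r i < m" "\<forall>j<4. c j < n" "\<forall>i<4. \<forall>j<4. X (r i) (c j) = D4 i j"
      by (rule has_perm_submatrixE)
    \<comment> \<open>The arrangement of \<open>hole5_D4\<close> read backwards, with
      \<open>p4\<close> placed in the row of \<open>p3\<close> and \<open>p0\<close> in the column
      of \<open>p1\<close>.\<close>
    then have "hole5 m n X (r 0, c 2) (r 1, c 1) (r 2, c 0) (r 2, c 3) (r 3, c 2)"
      unfolding all_less_numeral by (simp add: hole5_def rc_edge_def supp_def D4_def mat_of_rows_def)
    then show ?thesis by blast
  next
    case 2
    then obtain r c where "\<forall>i<3. r i < m" "\<forall>j<4. c j < n" "\<forall>i<3. \<forall>j<4. X (r i) (c j) = H3 i j"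
      by (rule has_perm_submatrixE)
    then have "hole5 m n X (r 0, c 0) (r 1, c 2) (r 1, c 3) (r 2, c 3) (r 2, c 1)"
      unfolding all_less_numeral by (simp add: hole5_def rc_edge_def supp_def H3_def mat_of_rows_def)
    then show ?thesis by blast
  next
    case 3
    then obtain r c where "\<forall>i<4. r i < m" "\<forall>j<3. c j < n" "\<forall>i<4. \<forall>j<3. X (r i) (c j) = H3 j i"
      unfolding H3T_def[symmetric] by (rule has_perm_submatrixE)
    \<comment> \<open>The hole chosen for \<open>H3\<close>, with the coordinates of each vertex
      swapped.\<close>
    then have "hole5 m n X (r 0, c 0) (r 2, c 1) (r 3, c 1) (r 3, c 2) (r 1, c 2)"
      unfolding all_less_numeral by (simp add: hole5_def rc_edge_def supp_def H3_def mat_of_rows_def)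
    then show ?thesis by blast
  next
    case 4
    then obtain r c where "\<forall>i<5. r i < m" "\<forall>j<5. c j < n" "\<forall>i<5. \<forall>j<5. X (r i) (c j) = K5 i j"
      by (rule has_perm_submatrixE)
    \<comment> \<open>The middle 1 of each cyclic block of three.\<close>
    then have "hole5 m n X (r 0, c 1) (r 1, c 2) (r 2, c 3) (r 3, c 4) (r 4, c 0)"
      unfolding all_less_numeral by (simp add: hole5_def rc_edge_def supp_def K5_def)
    then show ?thesis by blast
  qed
  then show ?thesis unfolding has_5hole_iff .
qed

theorem theorem2:
  fixes m n :: nat and X :: "nat \<Rightarrow> nat \<Rightarrow> bool"
  shows "has_5hole m n X \<longleftrightarrow>
           (has_perm_submatrix m n X 4 4 D4 \<or> has_perm_submatrix m n X 3 4 H3 \<or>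
            has_perm_submatrix m n X 4 3 H3T \<or> has_perm_submatrix m n X 5 5 K5)"
  using hole5_has_forbidden has_forbidden_has_5hole
  unfolding has_5hole_iff has_forbidden_def by blast

end
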